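(* Let $H^\tau$ be an oriented bipartite graph of order $m$ (an orientation of a bipartite graph $H$ with bipartition $(X,Y)$), and let the skew eigenvalues of $H^\tau$, listed with multiplicity, be the non-zero values $\pm\mu_1 i,\pm\mu_2 i,\dots,\pm\mu_t i$ together with $m-2t$ zeros. Let $G^\sigma$ be an oriented graph of order $n$, and let the skew eigenvalues of $G^\sigma$, listed with multiplicity, be the non-zero values $\pm\lambda_1 i,\pm\lambda_2 i,\dots,\pm\lambda_r i$ together with $n-2r$ zeros. (Here $\mu_j,\lambda_k$ are real.) Then the skew eigenvalues of the oriented graph $(H^\tau\Box G^\sigma)^o$, listed with multiplicity, are: \begin{itemize} \item $\pm i\sqrt{\mu_j^2+\lambda_k^2}$, each with multiplicity $2$, for $j=1,\dots,t$ and $k=1,\dots,r$; \item $\pm\mu_j i$, each with multiplicity $n-2r$, for $j=1,\dots,t$; \item $\pm\lambda_k i$, each with multiplicity $m-2t$, for $k=1,\dots,r$; \item $0$ with multiplicity $(m-2t)(n-2r)$. \end{itemize} (Multiplicities of coinciding values in this list are added.)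
   Context: All graphs are finite, simple and undirected; $i=\sqrt{-1}$. An orientation $\sigma$ of a graph $G$ with vertices $v_1,\dots,v_n$ assigns a direction to each edge of $G$; the resulting oriented graph is $G^\sigma$. Its skew-adjacency matrix $S(G^\sigma)=[s_{jk}]$ is the $n\times n$ matrix with $s_{jk}=1$ and $s_{kj}=-1$ if there is an arc from $v_j$ to $v_k$, and $s_{jk}=s_{kj}=0$ if $v_j,v_k$ are not adjacent. The skew eigenvalues of $G^\sigma$ are the eigenvalues of $S(G^\sigma)$; since this matrix is real skew-symmetric, they are purely imaginary or $0$ and the non-zero ones come in conjugate pairs. The Cartesian product $H\Box G$ has vertex set $V(H)\times V(G)$, with $(u_1,v_1)$ and $(u_2,v_2)$ adjacent if and only if $u_1=u_2$ and $v_1v_2\in E(G)$, or $v_1=v_2$ and $u_1u_2\in E(H)$. Given orientations $H^\tau$ and $G^\sigma$, the oriented graph $H^\tau\Box G^\sigma$ is the orientation of $H\Box G$ with an arc from $(u_1,v_1)$ to $(u_2,v_2)$ if and only if $u_1=u_2$ and $(v_1,v_2)$ is an arc of $G^\sigma$, or $v_1=v_2$ and $(u_1,u_2)$ is an arc of $H^\tau$. When $H$ is bipartite with bipartition $(X,Y)$, $(H^\tau\Box G^\sigma)^o$ denotes the orientation of $H\Box G$ obtained from $H^\tau\Box G^\sigma$ by reversing every arc from $(u,v_1)$ to $(u,v_2)$ with $u\in Y$, and leaving all other arcs unchanged. *)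

theory Defs
  imports
    "Graph_Theory.Pair_Digraph"
    "Jordan_Normal_Form.Char_Poly"
    "HOL-Computational_Algebra.Computational_Algebra"
    "HOL.Complex"
begin

text \<open>
  A finite simple undirected graph is a \<^locale>\<open>pair_graph\<close>: a finite, loop-free, symmetric
  set of ordered pairs of vertices, so that an edge \<open>uv\<close> contributes both \<open>(u, v)\<close> and \<open>(v, u)\<close>.
  An oriented graph is a \<^typ>\<open>'a pair_pre_digraph\<close> that picks exactly one of the two
  pairs for every edge of its underlying graph.
\<close>

definition orientation_of :: "'a pair_pre_digraph \<Rightarrow> 'a pair_pre_digraph \<Rightarrow> bool" where
  "orientation_of D G \<longleftrightarrow>
     pverts D = pverts G \<and> parcs D \<subseteq> parcs G \<and>
     (\<forall>(u, v) \<in> parcs G. (u, v) \<in> parcs D \<longleftrightarrow> (v, u) \<notin> parcs D)"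

definition bipartition :: "'a pair_pre_digraph \<Rightarrow> 'a set \<Rightarrow> 'a set \<Rightarrow> bool" where
  "bipartition G X Y \<longleftrightarrow>
     X \<union> Y = pverts G \<and> X \<inter> Y = {} \<and>
     (\<forall>(u, v) \<in> parcs G. u \<in> X \<and> v \<in> Y \<or> u \<in> Y \<and> v \<in> X)"

text \<open>
  The matrix depends on an ordering of the vertices, given as a list enumerating them.
\<close>

definition enumerates :: "'a list \<Rightarrow> 'a set \<Rightarrow> bool" where
  "enumerates vs V \<longleftrightarrow> distinct vs \<and> set vs = V"

definition skew_adjacency_matrix :: "'a list \<Rightarrow> 'a pair_pre_digraph \<Rightarrow> real mat" where
  "skew_adjacency_matrix vs D =
     mat (length vs) (length vs)
       (\<lambda>(j, k). if (vs ! j, vs ! k) \<in> parcs D then 1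
                 else if (vs ! k, vs ! j) \<in> parcs D then -1
                 else 0)"

text \<open>
  The eigenvalues of the real matrix are taken over the complex numbers and listed with algebraic
  multiplicity, i.e. as the multiset of roots of the characteristic polynomial.
\<close>

definition skew_eigenvalues :: "'a list \<Rightarrow> 'a pair_pre_digraph \<Rightarrow> complex multiset" where
  "skew_eigenvalues vs D =
     proots (char_poly (map_mat complex_of_real (skew_adjacency_matrix vs D)))"

text \<open>
  The same formula gives the Cartesian product of undirected graphs (as symmetric digraphs) and
  the product \<open>H\<^sup>\<tau> \<box> G\<^sup>\<sigma>\<close> of oriented graphs.
\<close>

definition cart_prod ::
    "'a pair_pre_digraph \<Rightarrow> 'b pair_pre_digraph \<Rightarrow> ('a \<times> 'b) pair_pre_digraph" where
  "cart_prod H G =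
     \<lparr> pverts = pverts H \<times> pverts G,
       parcs = {((u1, v1), (u2, v2)) | u1 v1 u2 v2.
                  u1 = u2 \<and> u1 \<in> pverts H \<and> (v1, v2) \<in> parcs G \<or>
                  v1 = v2 \<and> v1 \<in> pverts G \<and> (u1, u2) \<in> parcs H} \<rparr>"

definition reverse_arcs :: "'a pair_pre_digraph \<Rightarrow> 'a rel \<Rightarrow> 'a pair_pre_digraph" where
  "reverse_arcs D A =
     \<lparr> pverts = pverts D, parcs = (parcs D - A) \<union> (parcs D \<inter> A)\<inverse> \<rparr>"

text \<open>The orientation \<open>(H\<^sup>\<tau> \<box> G\<^sup>\<sigma>)\<^sup>o\<close>; \<open>Y\<close> is the second class of the bipartition of \<open>H\<close>.\<close>

definition cart_prod_o ::
    "'a set \<Rightarrow> 'a pair_pre_digraph \<Rightarrow> 'b pair_pre_digraph \<Rightarrow> ('a \<times> 'b) pair_pre_digraph" where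
  "cart_prod_o Y H G =
     reverse_arcs (cart_prod H G) {((u, v1), (u, v2)) | u v1 v2. u \<in> Y}"

lemma pair_graph_cart_prod:
  assumes "pair_graph H" "pair_graph G"
  shows "pair_graph (cart_prod H G)"
proof -
  interpret H: pair_graph H by fact
  interpret G: pair_graph G by fact
  have fin: "finite (pverts (cart_prod H G))"
    by (simp add: cart_prod_def H.pair_finite_verts G.pair_finite_verts)
  have sub: "parcs (cart_prod H G) \<subseteq> pverts (cart_prod H G) \<times> pverts (cart_prod H G)"
    by (auto simp: cart_prod_def dest: H.wellformed' G.wellformed')
  have finarcs: "finite (parcs (cart_prod H G))"
    by (rule finite_subset[OF sub]) (simp add: fin)
  have symH: "sym (parcs H)" and symG: "sym (parcs G)"
    using H.pair_sym_arcs G.pair_sym_arcs by (simp_all add: symmetric_def)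
  have "sym (parcs (cart_prod H G))"
    using symH symG by (auto simp: cart_prod_def sym_def)
  moreover have "fst e \<noteq> snd e" if "e \<in> parcs (cart_prod H G)" for e
    using that H.pair_no_loops G.pair_no_loops by (fastforce simp: cart_prod_def)
  ultimately show ?thesis
    using fin finarcs sub by unfold_locales (auto simp: symmetric_def)
qed

lemma orientation_of_cart_prod_o:
  assumes "pair_graph H" "pair_graph G" "orientation_of H\<tau> H" "orientation_of G\<sigma> G"
  shows "orientation_of (cart_prod_o Y H\<tau> G\<sigma>) (cart_prod H G)"
proof -
  interpret H: pair_graph H by fact
  interpret G: pair_graph G by fact
  have nl: "(u, u) \<notin> parcs H" "(v, v) \<notin> parcs G" for u v
    using H.pair_no_loops[of "(u, u)"] G.pair_no_loops[of "(v, v)"] by auto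
  have H1: "(u, v) \<in> parcs H \<longleftrightarrow> (u, v) \<in> parcs H\<tau> \<or> (v, u) \<in> parcs H\<tau>"
    and H2: "(u, v) \<in> parcs H\<tau> \<Longrightarrow> (v, u) \<notin> parcs H\<tau>"
    and H3: "(u, u) \<notin> parcs H\<tau>" for u v
    using assms(3) H.pair_sym_arcs nl(1)
    unfolding orientation_of_def symmetric_def sym_def with_proj_simps by blast+
  have G1: "(u, v) \<in> parcs G \<longleftrightarrow> (u, v) \<in> parcs G\<sigma> \<or> (v, u) \<in> parcs G\<sigma>"
    and G2: "(u, v) \<in> parcs G\<sigma> \<Longrightarrow> (v, u) \<notin> parcs G\<sigma>"
    and G3: "(u, u) \<notin> parcs G\<sigma>" for u v
    using assms(4) G.pair_sym_arcs nl(2)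
    unfolding orientation_of_def symmetric_def sym_def with_proj_simps by blast+
  have V: "pverts H\<tau> = pverts H" "pverts G\<sigma> = pverts G"
    using assms(3,4) by (auto simp: orientation_of_def)
  have P: "((a, b), (c, d)) \<in> parcs (cart_prod H G) \<longleftrightarrow>
      a = c \<and> a \<in> pverts H \<and> (b, d) \<in> parcs G \<or> b = d \<and> b \<in> pverts G \<and> (a, c) \<in> parcs H"
    for a b c d by (auto simp: cart_prod_def)
  have O: "((a, b), (c, d)) \<in> parcs (cart_prod_o Y H\<tau> G\<sigma>) \<longleftrightarrow>
      a = c \<and> a \<in> pverts H \<and> (if a \<in> Y then (d, b) \<in> parcs G\<sigma> else (b, d) \<in> parcs G\<sigma>)
      \<or> b = d \<and> b \<in> pverts G \<and> (a, c) \<in> parcs H\<tau>"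
    for a b c d
    using H3 G3 V by (auto simp: cart_prod_o_def reverse_arcs_def cart_prod_def)
  show ?thesis
    unfolding orientation_of_def
  proof (intro conjI subrelI ballI)
    show "pverts (cart_prod_o Y H\<tau> G\<sigma>) = pverts (cart_prod H G)"
      by (simp add: cart_prod_o_def reverse_arcs_def cart_prod_def V)
  next
    fix p q assume "(p, q) \<in> parcs (cart_prod_o Y H\<tau> G\<sigma>)"
    then show "(p, q) \<in> parcs (cart_prod H G)"
      by (cases p; cases q) (auto simp: O P H1 G1 split: if_splits)
  next
    fix e assume "e \<in> parcs (cart_prod H G)"
    then show "case e of (p, q) \<Rightarrow>
        (p, q) \<in> parcs (cart_prod_o Y H\<tau> G\<sigma>) \<longleftrightarrow> (q, p) \<notin> parcs (cart_prod_o Y H\<tau> G\<sigma>)"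
      by (cases e; cases "fst e"; cases "snd e")
        (auto simp: O P H1 G1 H3 G3 dest: H2 G2 split: if_splits)
  qed
qed

end

theory Submission
  imports Defs "Jordan_Normal_Form.Schur_Decomposition"
begin

text \<open>
  Write \<open>A\<close> and \<open>B\<close> for the skew-adjacency matrices of \<open>H\<^sup>\<tau>\<close> and \<open>G\<^sup>\<sigma>\<close>, and \<open>D\<close> for the diagonal matrix
  with entry \<open>1\<close> on \<open>X\<close> and \<open>-1\<close> on \<open>Y\<close>. Reversing the \<open>G\<close>-arcs in the fibres over \<open>Y\<close> multiplies their
  entries by \<open>-1\<close>, so the product has the matrix \<open>M = A \<otimes> I + D \<otimes> B\<close>
  (\<open>skew_matrix_cart_prod_o\<close>). Every edge of \<open>H\<close> joins \<open>X\<close> to \<open>Y\<close>, hence \<open>D A = - A D\<close>; together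
  with \<open>D\<^sup>2 = I\<close> this makes the cross terms of \<open>M\<^sup>2\<close> cancel:
  \<open>M\<^sup>2 = A\<^sup>2 \<otimes> I + I \<otimes> B\<^sup>2\<close> (\<open>kronecker_anticommuting_square\<close>). This is the purpose of the reversal.

  Unlike \<open>M\<close>, the matrix \<open>M\<^sup>2\<close> is a Kronecker sum, and Schur triangularisation of the two summands
  shows that its eigenvalues are all sums \<open>x\<^sup>2 + y\<^sup>2\<close> of an eigenvalue \<open>x\<^sup>2\<close> of \<open>A\<^sup>2\<close> and an eigenvalue
  \<open>y\<^sup>2\<close> of \<open>B\<^sup>2\<close> (\<open>char_poly_square\<close>, \<open>char_poly_kronecker_sum\<close>).

  To return from \<open>M\<^sup>2\<close> to \<open>M\<close> with multiplicities, use that \<open>M\<close> is skew-symmetric. Since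
  \<open>k\<^sup>2 I - M\<^sup>2 = (k I - M) (k I + M)\<close> and the second factor is the transpose of the first, the
  characteristic polynomials satisfy \<open>\<chi>(M)(k)\<^sup>2 = \<chi>(M\<^sup>2)(k\<^sup>2)\<close> (\<open>char_poly_skew_square\<close>). So every
  eigenvalue of \<open>M\<close>, counted twice, is a root of some \<open>k\<^sup>2 - (x\<^sup>2 + y\<^sup>2)\<close>
  (\<open>double_skew_eigenvalues_cart_prod_o\<close>). Summing over the pairs \<open>x = \<plusminus> \<mu>\<^sub>j i\<close> or \<open>0\<close> and
  \<open>y = \<plusminus> \<lambda>\<^sub>k i\<close> or \<open>0\<close>, each sign choice gives the same two roots, and every multiplicity comes out as
  twice the asserted one.
\<close>

section \<open>Matrices indexed by lists\<close>

text \<open>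
  Rows and columns carry labels taken from two lists. Matrix products then become sums over the set
  of labels. For a Kronecker product the labels are pairs, so these sums split into double sums, and
  vertices of a product graph are labels of the same kind.
\<close>

definition indexed_mat :: "'i list \<Rightarrow> 'j list \<Rightarrow> ('i \<Rightarrow> 'j \<Rightarrow> 'c) \<Rightarrow> 'c mat" where
  "indexed_mat xs ys f = mat (length xs) (length ys) (\<lambda>(i, j). f (xs ! i) (ys ! j))"

lemma indexed_mat_carrier [simp]: "indexed_mat xs ys f \<in> carrier_mat (length xs) (length ys)"
  by (simp add: indexed_mat_def)

lemma dim_indexed_mat [simp]:
  "dim_row (indexed_mat xs ys f) = length xs" "dim_col (indexed_mat xs ys f) = length ys"
  by (simp_all add: indexed_mat_def)

lemma index_indexed_mat [simp]:
  "i < length xs \<Longrightarrow> j < length ys \<Longrightarrow> indexed_mat xs ys f $$ (i, j) = f (xs ! i) (ys ! j)"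
  by (simp add: indexed_mat_def)

lemma indexed_mat_cong:
  assumes "\<And>x y. x \<in> set xs \<Longrightarrow> y \<in> set ys \<Longrightarrow> f x y = g x y"
  shows "indexed_mat xs ys f = indexed_mat xs ys g"
  using assms by (intro eq_matI) auto

lemma indexed_mat_one:
  assumes "distinct xs"
  shows "indexed_mat xs xs (\<lambda>x y. if x = y then 1 else 0) = 1\<^sub>m (length xs)"
  using assms by (intro eq_matI) (auto simp: nth_eq_iff_index_eq)

lemma indexed_mat_mult:
  fixes f :: "'i \<Rightarrow> 'j \<Rightarrow> 'c :: semiring_0"
  assumes "distinct ys"
  shows "indexed_mat xs ys f * indexed_mat ys zs g =
         indexed_mat xs zs (\<lambda>x z. \<Sum>y\<in>set ys. f x y * g y z)"
proof (rule eq_matI)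
  fix i k
  assume "i < dim_row (indexed_mat xs zs (\<lambda>x z. \<Sum>y\<in>set ys. f x y * g y z))"
    and "k < dim_col (indexed_mat xs zs (\<lambda>x z. \<Sum>y\<in>set ys. f x y * g y z))"
  then have i: "i < length xs" and k: "k < length zs" by simp_all
  have "bij_betw ((!) ys) {0..<length ys} (set ys)"
    using bij_betw_nth[OF assms] by (simp add: atLeast0LessThan)
  then have "(\<Sum>j = 0..<length ys. f (xs ! i) (ys ! j) * g (ys ! j) (zs ! k)) =
      (\<Sum>y\<in>set ys. f (xs ! i) y * g y (zs ! k))"
    by (rule sum.reindex_bij_betw)
  with i k show "(indexed_mat xs ys f * indexed_mat ys zs g) $$ (i, k) =
      indexed_mat xs zs (\<lambda>x z. \<Sum>y\<in>set ys. f x y * g y z) $$ (i, k)"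
    by (simp add: scalar_prod_def)
qed simp_all

text \<open>
  The two matrices are conjugate by the permutation matrix that matches equal labels. Hence the
  skew spectrum does not depend on the enumeration of the vertices.
\<close>

lemma similar_mat_reorder:
  fixes f :: "'i \<Rightarrow> 'i \<Rightarrow> 'c :: semiring_1"
  assumes "distinct xs" "distinct ys" "set xs = set ys"
  shows "similar_mat (indexed_mat xs xs f) (indexed_mat ys ys f)"
proof -
  have len: "length ys = length xs"
    using distinct_card[OF assms(1)] distinct_card[OF assms(2)] assms(3) by simp
  let ?d = "\<lambda>x y. if x = y then 1 else (0 :: 'c)"
  let ?P = "indexed_mat xs ys ?d" and ?Q = "indexed_mat ys xs ?d"
  have "?P * ?Q = indexed_mat xs xs ?d"
    unfolding indexed_mat_mult[OF assms(2)]
    by (rule indexed_mat_cong) (simp add: assms(3) mult_delta_left)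
  then have PQ: "?P * ?Q = 1\<^sub>m (length xs)"
    by (simp only: indexed_mat_one[OF assms(1)])
  have "?Q * ?P = indexed_mat ys ys ?d"
    unfolding indexed_mat_mult[OF assms(1)]
    by (rule indexed_mat_cong) (simp add: assms(3) mult_delta_left)
  then have QP: "?Q * ?P = 1\<^sub>m (length xs)"
    by (simp only: indexed_mat_one[OF assms(2)] len)
  have f: "indexed_mat xs xs f = ?P * indexed_mat ys ys f * ?Q"
    unfolding indexed_mat_mult[OF assms(2)]
  proof (rule indexed_mat_cong)
    fix x z assume "x \<in> set xs" "z \<in> set xs"
    moreover have "(\<Sum>y\<in>set ys. ?d x y * f y y') = f x y'" if "x \<in> set ys" for y'
      using that by (simp add: mult_delta_left)
    ultimately show "f x z = (\<Sum>y'\<in>set ys. (\<Sum>y\<in>set ys. ?d x y * f y y') * ?d y' z)"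
      unfolding assms(3) by (simp only: if_True) (simp add: mult_delta_right)
  qed
  have c: "{indexed_mat xs xs f, indexed_mat ys ys f, ?P, ?Q} \<subseteq> carrier_mat (length xs) (length xs)"
    using indexed_mat_carrier[of xs xs f] indexed_mat_carrier[of ys ys f]
      indexed_mat_carrier[of xs ys ?d] indexed_mat_carrier[of ys xs ?d]
    unfolding len by blast
  show "similar_mat (indexed_mat xs xs f) (indexed_mat ys ys f)"
    by (rule similar_matI[OF c PQ QP f])
qed

section \<open>Kronecker products\<close>

definition kronecker :: "'c :: semiring_0 mat \<Rightarrow> 'c mat \<Rightarrow> 'c mat" where
  "kronecker A B =
     indexed_mat (List.product [0..<dim_row A] [0..<dim_row B])
                 (List.product [0..<dim_col A] [0..<dim_col B])
                 (\<lambda>(i, j) (k, l). A $$ (i, k) * B $$ (j, l))"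

lemma kronecker_carrier [simp]:
  "A \<in> carrier_mat m m' \<Longrightarrow> B \<in> carrier_mat n n' \<Longrightarrow> kronecker A B \<in> carrier_mat (m * n) (m' * n')"
  by (auto simp: kronecker_def indexed_mat_def)

lemma div_mod_less:
  assumes "(i :: nat) < m * n"
  shows "i div n < m" "i mod n < n"
proof -
  have "0 < n" using assms by (cases n) auto
  with assms show "i div n < m" "i mod n < n" by (auto simp: less_mult_imp_div_less)
qed

lemma index_kronecker:
  assumes "A \<in> carrier_mat m m'" "B \<in> carrier_mat n n'" "i < m * n" "k < m' * n'"
  shows "kronecker A B $$ (i, k) = A $$ (i div n, k div n') * B $$ (i mod n, k mod n')"
  using assms div_mod_less[OF assms(3)] div_mod_less[OF assms(4)]
  by (simp add: kronecker_def product_nth)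

text \<open>
  The sum over pairs of labels factors into the two sums that define the products of the factors.
\<close>

lemma kronecker_mult:
  fixes A :: "'c :: comm_semiring_0 mat"
  assumes "A \<in> carrier_mat m m'" "B \<in> carrier_mat n n'" "A' \<in> carrier_mat m' m''" "B' \<in> carrier_mat n' n''"
  shows "kronecker A B * kronecker A' B' = kronecker (A * A') (B * B')"
proof -
  have "(\<Sum>(k, l)\<in>{0..<m'} \<times> {0..<n'}. A $$ (i, k) * B $$ (j, l) * (A' $$ (k, i') * B' $$ (l, j'))) =
      (A * A') $$ (i, i') * (B * B') $$ (j, j')"
    if "i < m" "j < n" "i' < m''" "j' < n''" for i j i' j'
    using that assms
    by (simp add: scalar_prod_def sum_product sum.cartesian_product mult.assoc mult.left_commute)
  with assms show ?thesis
    unfolding kronecker_def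
    by (simp add: indexed_mat_mult distinct_product split_beta)
      (rule indexed_mat_cong, auto simp: split_beta)
qed

lemma kronecker_one:
  "kronecker (1\<^sub>m m) (1\<^sub>m n) = (1\<^sub>m (m * n) :: 'c :: semiring_1 mat)"
proof (rule eq_matI)
  fix i k assume "i < dim_row (1\<^sub>m (m * n) :: 'c mat)" "k < dim_col (1\<^sub>m (m * n) :: 'c mat)"
  then have i: "i < m * n" and k: "k < m * n" by simp_all
  have "i = k \<longleftrightarrow> i div n = k div n \<and> i mod n = k mod n"
    by (metis div_mult_mod_eq)
  with i k show "kronecker (1\<^sub>m m) (1\<^sub>m n) $$ (i, k) = (1\<^sub>m (m * n) :: 'c mat) $$ (i, k)"
    by (auto simp: index_kronecker[of _ m m _ n n] div_mod_less)
qed (auto simp: kronecker_def)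

text \<open>
  Pairs are enumerated lexicographically: below the diagonal either the first labels already
  decrease, or they agree and the second labels decrease.
\<close>

lemma kronecker_upper_triangular:
  assumes "A \<in> carrier_mat m m" "B \<in> carrier_mat n n" "upper_triangular A" "upper_triangular B"
  shows "upper_triangular (kronecker A B)"
proof (rule upper_triangularI)
  fix i k assume "k < i" "i < dim_row (kronecker A B)"
  with assms(1,2) have ki: "k < i" "i < m * n" "k < m * n" by (simp_all add: kronecker_def)
  have "k div n < i div n \<or> k div n = i div n \<and> k mod n < i mod n"
    using ki(1) div_le_mono[of k i n]
    by (metis div_mult_mod_eq le_neq_implies_less less_imp_le nat_add_left_cancel_less)
  with assms ki show "kronecker A B $$ (i, k) = 0"
    using div_mod_less[OF ki(2)] div_mod_less[OF ki(3)]
    by (auto simp: index_kronecker[of _ m m _ n n] upper_triangularD)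
qed

lemma diag_mat_kronecker_sum:
  fixes A B :: "'c :: semiring_1 mat"
  assumes "A \<in> carrier_mat m m" "B \<in> carrier_mat n n"
  shows "diag_mat (kronecker A (1\<^sub>m n) + kronecker (1\<^sub>m m) B) =
         map (\<lambda>z. fst z + snd z) (List.product (diag_mat A) (diag_mat B))"
  using assms div_mod_less[of _ m n]
  by (intro nth_equalityI)
    (auto simp: diag_mat_def product_nth kronecker_def)


section \<open>Characteristic polynomials of Kronecker sums and squares\<close>

text \<open>
  If \<open>P\<close> and \<open>Q\<close> triangularise \<open>A\<close> and \<open>B\<close>, then \<open>P \<otimes> Q\<close> triangularises both \<open>A \<otimes> I\<close> and \<open>I \<otimes> B\<close>, and
  the diagonal of the resulting triangular matrix lists all sums of eigenvalues.
\<close>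

lemma char_poly_kronecker_sum:
  fixes A B :: "'c :: conjugatable_ordered_field mat"
  assumes A: "A \<in> carrier_mat m m" and B: "B \<in> carrier_mat n n"
    and cA: "char_poly A = (\<Prod>x\<leftarrow>xs. [:- x, 1:])" and cB: "char_poly B = (\<Prod>y\<leftarrow>ys. [:- y, 1:])"
  shows "char_poly (kronecker A (1\<^sub>m n) + kronecker (1\<^sub>m m) B) =
         (\<Prod>z\<leftarrow>List.product xs ys. [:- (fst z + snd z), 1:])"
proof -
  obtain T P P' where "schur_decomposition A xs = (T, P, P')" by (cases "schur_decomposition A xs")
  from schur_decomposition[OF A cA this]
  have simA: "similar_mat_wit A T P P'" and T: "upper_triangular T" "diag_mat T = xs" by auto
  obtain U Q Q' where "schur_decomposition B ys = (U, Q, Q')" by (cases "schur_decomposition B ys")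
  from schur_decomposition[OF B cB this]
  have simB: "similar_mat_wit B U Q Q'" and U: "upper_triangular U" "diag_mat U = ys" by auto
  note a = similar_mat_witD2[OF A simA] and b = similar_mat_witD2[OF B simB]
  note [simp] = a(4-7) b(4-7)
  let ?K = "kronecker A (1\<^sub>m n) + kronecker (1\<^sub>m m) B"
  let ?L = "kronecker T (1\<^sub>m n) + kronecker (1\<^sub>m m) U"
  let ?W = "kronecker P Q" and ?W' = "kronecker P' Q'"
  note k_mult = kronecker_mult[of _ m m _ n n _ m _ n]
  note mult_carrier [simp] = mult_carrier_mat[of _ "m * n" "m * n" _ "m * n"] mult_carrier_mat[of _ m m _ m]
    mult_carrier_mat[of _ n n _ n]
  have k [simp]: "kronecker X Y \<in> carrier_mat (m * n) (m * n)"
    if "X \<in> carrier_mat m m" "Y \<in> carrier_mat n n" for X Y :: "'c mat"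
    using that by simp
  have "?W * ?L * ?W' = ?W * kronecker T (1\<^sub>m n) * ?W' + ?W * kronecker (1\<^sub>m m) U * ?W'"
    by (simp add: mult_add_distrib_mat[of _ "m * n" "m * n" _ "m * n"]
        add_mult_distrib_mat[of _ "m * n" "m * n" _ _ "m * n"] del: assoc_mult_mat)
  also have "?W * kronecker T (1\<^sub>m n) * ?W' = kronecker A (1\<^sub>m n)"
    using b(1) by (simp add: k_mult right_mult_one_mat[of Q n n] a(3)[symmetric] del: assoc_mult_mat)
  also have "?W * kronecker (1\<^sub>m m) U * ?W' = kronecker (1\<^sub>m m) B"
    using a(1) by (simp add: k_mult right_mult_one_mat[of P m m] b(3)[symmetric] del: assoc_mult_mat)
  finally have "?K = ?W * ?L * ?W'" ..
  then have "similar_mat_wit ?K ?L ?W ?W'"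
    by (intro similar_mat_witI[of _ _ "m * n"])
      (simp_all add: k_mult kronecker_one a(1,2) b(1,2))
  then have "char_poly ?K = char_poly ?L"
    by (intro char_poly_similar) (auto simp: similar_mat_def)
  moreover have "upper_triangular ?L"
  proof (rule upper_triangularI)
    fix i k assume "k < i" "i < dim_row ?L"
    then have ki: "k < i" "i < m * n" "k < m * n"
      using carrier_matD[OF b(5)] by (simp_all add: kronecker_def)
    have "upper_triangular (kronecker T (1\<^sub>m n))" "upper_triangular (kronecker (1\<^sub>m m) U)"
      using T U by (auto intro!: kronecker_upper_triangular[of _ m _ n])
    from this[THEN upper_triangularD, of k i] ki show "?L $$ (i, k) = 0"
      using carrier_matD[OF k[OF a(5) one_carrier_mat]] carrier_matD[OF k[OF one_carrier_mat b(5)]]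
      by simp
  qed
  then have "char_poly ?L = (\<Prod>x\<leftarrow>diag_mat ?L. [:- x, 1:])"
    by (intro char_poly_upper_triangular[of _ "m * n"]) simp_all
  ultimately show ?thesis
    by (simp add: diag_mat_kronecker_sum T U o_def split_beta)
qed

text \<open>
  A triangular form \<open>T\<close> of \<open>A\<close> gives the triangular form \<open>T\<^sup>2\<close> of \<open>A\<^sup>2\<close>, whose diagonal entries are the
  squares of those of \<open>T\<close>.
\<close>

lemma char_poly_square:
  fixes A :: "'c :: conjugatable_ordered_field mat"
  assumes A: "A \<in> carrier_mat m m" and cA: "char_poly A = (\<Prod>x\<leftarrow>xs. [:- x, 1:])"
  shows "char_poly (A * A) = (\<Prod>x\<leftarrow>xs. [:- x\<^sup>2, 1:])"
proof -
  obtain T P P' where "schur_decomposition A xs = (T, P, P')" by (cases "schur_decomposition A xs")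
  from schur_decomposition[OF A cA this]
  have simA: "similar_mat_wit A T P P'" and T: "upper_triangular T" "diag_mat T = xs" by auto
  note a = similar_mat_witD2[OF A simA]
  have TT: "(T * T) $$ (i, k) = (if i = k then (T $$ (i, i))\<^sup>2 else 0)" if "k \<le> i" "i < m" for i k
  proof -
    have "(T * T) $$ (i, k) = (\<Sum>j = 0..<m. T $$ (i, j) * T $$ (j, k))"
      using a(5) that by (simp add: scalar_prod_def)
    also have "\<dots> = (\<Sum>j = 0..<m. if j = i then T $$ (i, i) * T $$ (i, k) else 0)"
    proof (rule sum.cong[OF refl])
      fix j assume "j \<in> {0..<m}"
      then show "T $$ (i, j) * T $$ (j, k) = (if j = i then T $$ (i, i) * T $$ (i, k) else 0)"
        using a(5) T(1) that upper_triangularD[of T j i] upper_triangularD[of T k j]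
        by (cases j i rule: linorder_cases) auto
    qed
    also have "\<dots> = T $$ (i, i) * T $$ (i, k)"
      using that by simp
    finally show ?thesis
      using a(5) T(1) that upper_triangularD[of T k i] by (auto simp: power2_eq_square)
  qed
  have "A * A = P * T * (P' * P) * T * P'"
    using a(4-7) unfolding a(3) by (simp add: assoc_mult_mat[of _ m m _ m _ m])
  also have "\<dots> = P * (T * T) * P'"
    using a(4-7) a(2) by (simp add: assoc_mult_mat[of _ m m _ m _ m])
  finally have "similar_mat_wit (A * A) (T * T) P P'"
    using a A by (intro similar_mat_witI[of _ _ m]) auto
  then have "char_poly (A * A) = char_poly (T * T)"
    by (intro char_poly_similar) (auto simp: similar_mat_def)
  also have "\<dots> = (\<Prod>x\<leftarrow>diag_mat (T * T). [:- x, 1:])"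
    using a(5) TT by (intro char_poly_upper_triangular[of _ m]) (auto intro!: upper_triangularI)
  also have "diag_mat (T * T) = map (\<lambda>x. x\<^sup>2) xs"
    unfolding T(2)[symmetric] using a(5) TT by (intro nth_equalityI) (auto simp: diag_mat_def)
  finally show ?thesis by (simp add: o_def)
qed

text \<open>
  For \<open>C = k I - A\<close>, skew symmetry gives \<open>C\<^sup>T = k I + A\<close>, so \<open>C C\<^sup>T = k\<^sup>2 I - A\<^sup>2\<close> and
  \<open>det (k\<^sup>2 I - A\<^sup>2) = (det C)\<^sup>2\<close>. The polynomial identity follows since it holds at every \<open>k\<close>.
\<close>

lemma char_poly_skew_square:
  fixes A :: "'c :: field_char_0 mat"
  assumes A: "A \<in> carrier_mat n n" and skew: "transpose_mat A = - A"
  shows "(char_poly A)\<^sup>2 = pcompose (char_poly (A * A)) [:0, 0, 1:]"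
proof -
  have "poly ((char_poly A)\<^sup>2) k = poly (pcompose (char_poly (A * A)) [:0, 0, 1:]) k" for k
  proof -
    have AA: "A * A \<in> carrier_mat n n" using A by simp
    let ?C = "k \<cdot>\<^sub>m 1\<^sub>m n - A"
    have C: "?C \<in> carrier_mat n n" using A by (intro minus_carrier_mat)
    have ct: "transpose_mat ?C = k \<cdot>\<^sub>m 1\<^sub>m n + A"
    proof (rule eq_matI)
      fix i j assume "i < dim_row (k \<cdot>\<^sub>m 1\<^sub>m n + A)" "j < dim_col (k \<cdot>\<^sub>m 1\<^sub>m n + A)"
      then show "transpose_mat ?C $$ (i, j) = (k \<cdot>\<^sub>m 1\<^sub>m n + A) $$ (i, j)"
        using A arg_cong[OF skew, of "\<lambda>M. M $$ (i, j)"] by (auto simp: algebra_simps)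
    qed (use A in auto)
    have "?C * transpose_mat ?C = k\<^sup>2 \<cdot>\<^sub>m 1\<^sub>m n - A * A"
      unfolding ct using A
      by (simp add: mult_add_distrib_mat[of _ n n _ n] minus_mult_distrib_mat[of _ n n _ _ n]
          mult_smult_distrib[of _ n n _ n] mult_smult_assoc_mat[of _ n n _ n] power2_eq_square)
        (auto intro!: eq_matI)
    then have "det (k\<^sup>2 \<cdot>\<^sub>m 1\<^sub>m n - A * A) = (det ?C)\<^sup>2"
      using det_mult[OF C, of "transpose_mat ?C"] C det_transpose[OF C] by (simp add: power2_eq_square)
    moreover have "- char_matrix A k = ?C" "- char_matrix (A * A) (k\<^sup>2) = k\<^sup>2 \<cdot>\<^sub>m 1\<^sub>m n - A * A"
      using A by (auto intro!: eq_matI simp: char_matrix_def)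
    ultimately show ?thesis
      using char_poly_matrix[OF A, of k] char_poly_matrix[OF AA, of "k\<^sup>2"]
      by (simp add: poly_pcompose power2_eq_square)
  qed
  then show ?thesis by (simp add: poly_eq_poly_eq_iff[symmetric] fun_eq_iff)
qed

text \<open>
  The cross terms are \<open>A D \<otimes> B\<close> and \<open>D A \<otimes> B = - (A D \<otimes> B)\<close>.
\<close>

lemma kronecker_anticommuting_square:
  fixes A :: "'c :: comm_ring_1 mat"
  assumes A: "A \<in> carrier_mat m m" and D: "D \<in> carrier_mat m m" and B: "B \<in> carrier_mat n n"
    and DD: "D * D = 1\<^sub>m m" and DA: "D * A = - (A * D)"
  defines "M \<equiv> kronecker A (1\<^sub>m n) + kronecker D B"
  shows "M * M = kronecker (A * A) (1\<^sub>m n) + kronecker (1\<^sub>m m) (B * B)"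
proof -
  let ?N = "m * n"
  have k: "kronecker X Y \<in> carrier_mat ?N ?N"
    if "X \<in> carrier_mat m m" "Y \<in> carrier_mat n n" for X Y :: "'c mat"
    using that by simp
  have c: "A * A \<in> carrier_mat m m" "A * D \<in> carrier_mat m m" "D * A \<in> carrier_mat m m"
    "B * B \<in> carrier_mat n n"
    using A B D by auto
  let ?S = "kronecker A (1\<^sub>m n)" and ?R = "kronecker D B"
  have S: "?S \<in> carrier_mat ?N ?N" and R: "?R \<in> carrier_mat ?N ?N"
    using A B D by (auto intro: k)
  have "M * M = (?S * ?S + ?R * ?S) + (?S * ?R + ?R * ?R)"
    unfolding M_def using S R
    by (simp add: mult_add_distrib_mat[of _ ?N ?N _ ?N] add_mult_distrib_mat[of _ ?N ?N _ _ ?N])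
  also have "\<dots> = (kronecker (A * A) (1\<^sub>m n) + kronecker (- (A * D)) B) +
      (kronecker (A * D) B + kronecker (1\<^sub>m m) (B * B))"
    using A B D DD DA by (simp add: kronecker_mult[of _ m m _ n n _ m _ n])
  also have "\<dots> = kronecker (A * A) (1\<^sub>m n) + kronecker (1\<^sub>m m) (B * B)"
  proof (rule eq_matI, goal_cases)
    case (1 i k)
    then have ik: "i < ?N" "k < ?N" using c B by (auto simp: kronecker_def)
    note div_mod_less[OF ik(1)] div_mod_less[OF ik(2)]
    then have neg: "kronecker (- (A * D)) B $$ (i, k) = - kronecker (A * D) B $$ (i, k)"
      using c B ik carrier_matD[OF c(2)] by (simp add: index_kronecker[of _ m m _ n n])
    have d: "dim_row (kronecker X Y) = ?N" "dim_col (kronecker X Y) = ?N"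
      if "X \<in> carrier_mat m m" "Y \<in> carrier_mat n n" for X Y :: "'c mat"
      using k[OF that] by auto
    show ?case
      using ik c B neg by (simp add: d)
  qed (use B c in \<open>auto simp: kronecker_def\<close>)
  finally show ?thesis .
qed

section \<open>The matrix of the modified Cartesian product\<close>

definition skew_entry :: "'a pair_pre_digraph \<Rightarrow> 'a \<Rightarrow> 'a \<Rightarrow> complex" where
  "skew_entry D u v = (if (u, v) \<in> parcs D then 1 else if (v, u) \<in> parcs D then -1 else 0)"

lemma skew_eigenvalues_indexed_mat:
  "skew_eigenvalues vs D = proots (char_poly (indexed_mat vs vs (skew_entry D)))"
proof -
  have "map_mat complex_of_real (skew_adjacency_matrix vs D) = indexed_mat vs vs (skew_entry D)"
    by (intro eq_matI) (auto simp: skew_adjacency_matrix_def skew_entry_def)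
  then show ?thesis by (simp add: skew_eigenvalues_def)
qed

lemma orientation_of_asym:
  "orientation_of D G \<Longrightarrow> (u, v) \<in> parcs D \<Longrightarrow> (v, u) \<notin> parcs D"
  by (auto simp: orientation_of_def)

lemma skew_entry_flip:
  assumes "orientation_of D G"
  shows "skew_entry D v u = - skew_entry D u v"
  using orientation_of_asym[OF assms] by (auto simp: skew_entry_def)

lemma transpose_skew:
  assumes "orientation_of D G"
  shows "transpose_mat (indexed_mat vs vs (skew_entry D)) = - indexed_mat vs vs (skew_entry D)"
proof (rule eq_matI, goal_cases)
  case (1 i j)
  then show ?case using skew_entry_flip[OF assms, where u = "vs ! i" and v = "vs ! j"] by simp
qed simp_all

text \<open>
  The entries of the diagonal matrix \<open>D\<close>, as a function of two labels so that it can be passed to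
  \<open>indexed_mat\<close>.
\<close>

definition class_sign :: "'a set \<Rightarrow> 'a \<Rightarrow> 'a \<Rightarrow> complex" where
  "class_sign Y u u' = (if u = u' then if u \<in> Y then -1 else 1 else 0)"

lemma class_sign_square:
  assumes "distinct us"
  shows "indexed_mat us us (class_sign Y) * indexed_mat us us (class_sign Y) = 1\<^sub>m (length us)"
proof -
  have "(\<Sum>y\<in>set us. class_sign Y x y * class_sign Y y z) = (if x = z then 1 else 0)"
    if "x \<in> set us" for x z
  proof -
    have "(\<Sum>y\<in>set us. class_sign Y x y * class_sign Y y z) =
        (\<Sum>y\<in>set us. if x = y then if x = z then 1 else 0 else 0)"
      by (rule sum.cong) (auto simp: class_sign_def)
    with that show ?thesis by simp
  qed
  then show ?thesis
    unfolding indexed_mat_mult[OF assms] indexed_mat_one[OF assms, symmetric]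
    by (intro indexed_mat_cong)
qed

text \<open>
  A non-zero entry of the skew-adjacency matrix belongs to an edge, whose ends have opposite signs;
  multiplying by \<open>D\<close> from the left or from the right uses the sign of the one end or of the other.
\<close>

lemma class_sign_anticommute:
  assumes "distinct us" and bip: "bipartition G X Y" and ori: "orientation_of D G"
  shows "indexed_mat us us (class_sign Y) * indexed_mat us us (skew_entry D) =
         - (indexed_mat us us (skew_entry D) * indexed_mat us us (class_sign Y))"
proof -
  let ?s = "\<lambda>u. if u \<in> Y then -1 else (1 :: complex)"
  have cross: "(x \<in> Y) \<noteq> (z \<in> Y)" if "skew_entry D x z \<noteq> 0" for x z
  proof -
    have "(x, z) \<in> parcs G \<or> (z, x) \<in> parcs G"
      using that ori by (auto simp: skew_entry_def orientation_of_def split: if_splits)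
    with bip show ?thesis by (auto simp: bipartition_def)
  qed
  have left: "(\<Sum>y\<in>set us. class_sign Y x y * skew_entry D y z) = ?s x * skew_entry D x z"
    if "x \<in> set us" for x z
  proof -
    have "(\<Sum>y\<in>set us. class_sign Y x y * skew_entry D y z) =
        (\<Sum>y\<in>set us. if x = y then ?s x * skew_entry D x z else 0)"
      by (rule sum.cong) (auto simp: class_sign_def)
    with that show ?thesis by simp
  qed
  have right: "(\<Sum>y\<in>set us. skew_entry D x y * class_sign Y y z) = ?s z * skew_entry D x z"
    if "z \<in> set us" for x z
  proof -
    have "(\<Sum>y\<in>set us. skew_entry D x y * class_sign Y y z) =
        (\<Sum>y\<in>set us. if y = z then ?s z * skew_entry D x z else 0)"
      by (rule sum.cong) (auto simp: class_sign_def)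
    with that show ?thesis by simp
  qed
  have "?s x * skew_entry D x z = - (?s z * skew_entry D x z)" for x z
    using cross[of x z] by (cases "skew_entry D x z = 0") auto
  then show ?thesis
    unfolding indexed_mat_mult[OF assms(1)]
    by (intro eq_matI) (simp_all add: left right)
qed

text \<open>
  Since there are no loops, at most one of the two summands is non-zero. For \<open>u \<in> Y\<close> the reversed
  arc changes the sign of the second one.
\<close>

lemma skew_entry_cart_prod_o:
  assumes H: "orientation_of H H0" and G: "orientation_of G G0"
    and V: "u \<in> pverts H" "u' \<in> pverts H" "v \<in> pverts G" "v' \<in> pverts G"
  shows "skew_entry (cart_prod_o Y H G) (u, v) (u', v') =
         skew_entry H u u' * (if v = v' then 1 else 0) + class_sign Y u u' * skew_entry G v v'"
proof -
  have loop: "(x, x) \<notin> parcs H" "(y, y) \<notin> parcs G" for x y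
    using orientation_of_asym[OF H] orientation_of_asym[OF G] by blast+
  have arc: "((a, b), (c, d)) \<in> parcs (cart_prod_o Y H G) \<longleftrightarrow>
      a = c \<and> a \<in> pverts H \<and> (if a \<in> Y then (d, b) \<in> parcs G else (b, d) \<in> parcs G)
      \<or> b = d \<and> b \<in> pverts G \<and> (a, c) \<in> parcs H" for a b c d
    using loop by (auto simp: cart_prod_o_def reverse_arcs_def cart_prod_def)
  show ?thesis
    using V loop orientation_of_asym[OF H, of u u'] orientation_of_asym[OF G, of v v']
    by (auto simp: skew_entry_def class_sign_def arc)
qed

lemma skew_matrix_cart_prod_o:
  assumes H: "orientation_of H H0" and G: "orientation_of G G0"
    and us: "set us = pverts H" and vs: "set vs = pverts G" "distinct vs"
  shows "indexed_mat (List.product us vs) (List.product us vs) (skew_entry (cart_prod_o Y H G)) =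
         kronecker (indexed_mat us us (skew_entry H)) (1\<^sub>m (length vs)) +
         kronecker (indexed_mat us us (class_sign Y)) (indexed_mat vs vs (skew_entry G))"
    (is "?M = ?K")
proof (rule eq_matI)
  let ?m = "length us" and ?n = "length vs"
  fix i k assume "i < dim_row ?K" "k < dim_col ?K"
  then have ik: "i < ?m * ?n" "k < ?m * ?n" by (simp_all add: kronecker_def)
  note div_mod = div_mod_less[OF ik(1)] div_mod_less[OF ik(2)]
  have "us ! (i div ?n) \<in> pverts H" "us ! (k div ?n) \<in> pverts H"
    "vs ! (i mod ?n) \<in> pverts G" "vs ! (k mod ?n) \<in> pverts G"
    using div_mod us vs(1) nth_mem by blast+
  note entry = skew_entry_cart_prod_o[OF H G this]
  have "?K $$ (i, k) = kronecker (indexed_mat us us (skew_entry H)) (1\<^sub>m ?n) $$ (i, k) +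
      kronecker (indexed_mat us us (class_sign Y)) (indexed_mat vs vs (skew_entry G)) $$ (i, k)"
    using ik by (intro index_add_mat(1)) (simp_all add: kronecker_def)
  also have "\<dots> = skew_entry H (us ! (i div ?n)) (us ! (k div ?n)) * (if i mod ?n = k mod ?n then 1 else 0) +
      class_sign Y (us ! (i div ?n)) (us ! (k div ?n)) * skew_entry G (vs ! (i mod ?n)) (vs ! (k mod ?n))"
    using ik div_mod by (simp add: index_kronecker[of _ ?m ?m _ ?n ?n])
  also have "\<dots> = ?M $$ (i, k)"
    using ik div_mod vs(2) by (simp add: product_nth entry nth_eq_iff_index_eq)
  finally show "?M $$ (i, k) = ?K $$ (i, k)" ..
qed (simp_all add: kronecker_def)

section \<open>Multisets of roots\<close>

lemma proots_prod_linear: "proots (\<Prod>x\<leftarrow>xs. [:- x, 1:]) = mset (xs :: 'a :: idom list)"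
proof (induction xs)
  case (Cons x xs)
  have "(\<Prod>x\<leftarrow>xs. [:- x, 1:]) \<noteq> 0" by auto
  then have "proots ([:- x, 1:] * (\<Prod>x\<leftarrow>xs. [:- x, 1:])) = {#x#} + proots (\<Prod>x\<leftarrow>xs. [:- x, 1:])"
    by (subst proots_mult) auto
  with Cons.IH show ?case by simp
qed simp

lemma proots_square_minus_square:
  fixes c :: "'a :: idom"
  shows "proots [:- c\<^sup>2, 0, 1:] = {#c, - c#}"
proof -
  have "[:- c\<^sup>2, 0, 1:] = [:- c, 1:] * [:c, 1:]" by (simp add: power2_eq_square)
  then show ?thesis by (simp add: proots_mult del: mult_pCons_left mult_pCons_right)
qed

lemma pcompose_prod_list: "pcompose (\<Prod>x\<leftarrow>xs. f x) q = (\<Prod>x\<leftarrow>xs. pcompose (f x) q)"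
  by (induction xs) (simp_all add: pcompose_mult pcompose_1)

lemma proots_prod_list_map:
  assumes "\<And>x. x \<in> set xs \<Longrightarrow> f x \<noteq> 0"
  shows "proots (\<Prod>x\<leftarrow>xs. f x) = (\<Sum>x\<leftarrow>xs. proots (f x))"
proof -
  have "0 \<notin> set (map f xs)" using assms by fastforce
  from proots_prod_list[OF this] show ?thesis by (simp add: o_def)
qed

lemma sum_list_product:
  fixes f :: "'a \<times> 'b \<Rightarrow> 'c :: comm_monoid_add"
  shows "(\<Sum>z\<leftarrow>List.product xs ys. f z) = (\<Sum>x\<in>#mset xs. \<Sum>y\<in>#mset ys. f (x, y))"
proof (induction xs)
  case (Cons x xs)
  have "(\<Sum>y\<in>#mset ys. f (x, y)) = (\<Sum>y\<leftarrow>ys. f (x, y))"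
    by (metis mset_map sum_mset_sum_list)
  with Cons.IH show ?case by (simp add: o_def)
qed simp

lemma product_map_map:
  "List.product (map f xs) (map g ys) = map (\<lambda>(x, y). (f x, g y)) (List.product xs ys)"
  by (induction xs) (simp_all add: o_def)

text \<open>
  An even function takes the same value at both members of a pair \<open>\<plusminus> a\<^sub>j\<close>; this is where the factors
  \<open>2\<close> in the multiplicities come from.
\<close>

lemma sum_mset_symmetric:
  fixes f :: "'a :: group_add \<Rightarrow> 'b multiset"
  assumes even: "\<And>x. f (- x) = f x"
  shows "(\<Sum>x\<in>#(\<Sum>j\<in>J. {#a j, - a j#}) + replicate_mset z 0. f x) =
         repeat_mset 2 (\<Sum>j\<in>J. f (a j)) + repeat_mset z (f 0)"
proof -
  have "(\<Sum>x\<in>#(\<Sum>j\<in>J. {#a j, - a j#}). f x) = repeat_mset 2 (\<Sum>j\<in>J. f (a j))"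
    by (induction J rule: infinite_finite_induct) (simp_all add: even numeral_2_eq_2)
  moreover have "(\<Sum>x\<in>#replicate_mset z 0. f x) = repeat_mset z (f 0)"
    by (induction z) simp_all
  ultimately show ?thesis by simp
qed

section \<open>The spectrum of the product\<close>

text \<open>
  The spectrum is described with every multiplicity doubled, because it is \<open>\<chi>(M)\<^sup>2\<close> rather than \<open>\<chi>(M)\<close>
  that is expressed through \<open>M\<^sup>2\<close>.
\<close>

lemma double_skew_eigenvalues_cart_prod_o:
  assumes H: "orientation_of H H0" and G: "orientation_of G G0" and bip: "bipartition H0 X Y"
    and us: "enumerates us (pverts H)" and vs: "enumerates vs (pverts G)"
    and ws: "enumerates ws (pverts (cart_prod_o Y H G))"
    and GH: "orientation_of (cart_prod_o Y H G) K"
  shows "repeat_mset 2 (skew_eigenvalues ws (cart_prod_o Y H G)) =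
         (\<Sum>x\<in>#skew_eigenvalues us H. \<Sum>y\<in>#skew_eigenvalues vs G. proots [:- (x\<^sup>2 + y\<^sup>2), 0, 1:])"
proof -
  let ?m = "length us" and ?n = "length vs" and ?P = "cart_prod_o Y H G"
  let ?A = "indexed_mat us us (skew_entry H)" and ?B = "indexed_mat vs vs (skew_entry G)"
  let ?ps = "List.product us vs"
  let ?M = "indexed_mat ?ps ?ps (skew_entry ?P)"
  have d: "distinct us" "distinct vs" "distinct ws" and s: "set us = pverts H" "set vs = pverts G"
    "set ws = set ?ps"
    using us vs ws by (auto simp: enumerates_def cart_prod_o_def reverse_arcs_def cart_prod_def)
  obtain xs where xs: "char_poly ?A = (\<Prod>x\<leftarrow>xs. [:- x, 1:])"
    using char_poly_factorized[of ?A ?m] by auto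
  obtain ys where ys: "char_poly ?B = (\<Prod>y\<leftarrow>ys. [:- y, 1:])"
    using char_poly_factorized[of ?B ?n] by auto
  have spec: "skew_eigenvalues us H = mset xs" "skew_eigenvalues vs G = mset ys"
    unfolding skew_eigenvalues_indexed_mat xs ys by (rule proots_prod_linear)+
  have "char_poly (indexed_mat ws ws (skew_entry ?P)) = char_poly ?M"
    using d s(3) by (intro char_poly_similar similar_mat_reorder) (simp_all add: distinct_product)
  then have "repeat_mset 2 (skew_eigenvalues ws ?P) = proots ((char_poly ?M)\<^sup>2)"
    by (simp add: skew_eigenvalues_indexed_mat proots_power)
  also have "(char_poly ?M)\<^sup>2 = pcompose (char_poly (?M * ?M)) [:0, 0, 1:]"
    using indexed_mat_carrier transpose_skew[OF GH] by (rule char_poly_skew_square)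
  also have "?M * ?M = kronecker (?A * ?A) (1\<^sub>m ?n) + kronecker (1\<^sub>m ?m) (?B * ?B)"
    unfolding skew_matrix_cart_prod_o[OF H G s(1,2) d(2)]
    by (rule kronecker_anticommuting_square[OF indexed_mat_carrier indexed_mat_carrier indexed_mat_carrier
          class_sign_square[OF d(1)] class_sign_anticommute[OF d(1) bip H]])
  also have "char_poly \<dots> =
      (\<Prod>z\<leftarrow>List.product (map (\<lambda>x. x\<^sup>2) xs) (map (\<lambda>y. y\<^sup>2) ys). [:- (fst z + snd z), 1:])"
  proof (rule char_poly_kronecker_sum)
    show "?A * ?A \<in> carrier_mat ?m ?m" "?B * ?B \<in> carrier_mat ?n ?n" by auto
    show "char_poly (?A * ?A) = (\<Prod>x\<leftarrow>map (\<lambda>x. x\<^sup>2) xs. [:- x, 1:])"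
      using char_poly_square[OF indexed_mat_carrier xs] by (simp add: o_def)
    show "char_poly (?B * ?B) = (\<Prod>x\<leftarrow>map (\<lambda>x. x\<^sup>2) ys. [:- x, 1:])"
      using char_poly_square[OF indexed_mat_carrier ys] by (simp add: o_def)
  qed
  also have "pcompose \<dots> [:0, 0, 1:] = (\<Prod>z\<leftarrow>List.product xs ys. [:- ((fst z)\<^sup>2 + (snd z)\<^sup>2), 0, 1:])"
    by (simp add: product_map_map pcompose_prod_list o_def split_beta pcompose_pCons)
  also have "proots \<dots> = (\<Sum>z\<leftarrow>List.product xs ys. proots [:- ((fst z)\<^sup>2 + (snd z)\<^sup>2), 0, 1:])"
    by (rule proots_prod_list_map) simp
  also have "\<dots> = (\<Sum>x\<in>#mset xs. \<Sum>y\<in>#mset ys. proots [:- (x\<^sup>2 + y\<^sup>2), 0, 1:])"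
    by (simp add: sum_list_product)
  finally show ?thesis unfolding spec .
qed

text \<open>
  The left-hand side is the double sum of the roots after summing over both signs of both
  eigenvalues. Here \<open>C j k\<close> stands for the root pair of \<open>(\<mu>\<^sub>j, \<lambda>\<^sub>k)\<close>, \<open>A j\<close> and \<open>B k\<close> for those of
  \<open>(\<mu>\<^sub>j, 0)\<close> and \<open>(0, \<lambda>\<^sub>k)\<close>, \<open>a + a\<close> for the double root \<open>0\<close>, and \<open>z\<close>, \<open>q\<close> for the numbers of zero
  eigenvalues. All multiplicities are even, so a factor \<open>2\<close> can be extracted.
\<close>

lemma collect_doubled_multiplicities:
  fixes A B :: "'i \<Rightarrow> 'b multiset"
  shows "repeat_mset 2 (\<Sum>j\<in>J. repeat_mset 2 (\<Sum>k\<in>K. C j k) + repeat_mset q (A j)) +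
         repeat_mset z (repeat_mset 2 (\<Sum>k\<in>K. B k) + repeat_mset q (a + a)) =
         repeat_mset 2 ((\<Sum>j\<in>J. \<Sum>k\<in>K. repeat_mset 2 (C j k)) + (\<Sum>j\<in>J. repeat_mset q (A j)) +
           (\<Sum>k\<in>K. repeat_mset z (B k)) + repeat_mset (z * q) a)"
  by (rule multiset_eqI) (simp add: count_sum sum.distrib sum_distrib_left algebra_simps)

theorem theorem3p1:
  fixes H H\<tau> :: "'a pair_pre_digraph" and G G\<sigma> :: "'b pair_pre_digraph"
    and X Y :: "'a set"
    and us :: "'a list" and vs :: "'b list" and ws :: "('a \<times> 'b) list"
    and m n t r :: nat
    and \<mu> lam :: "nat \<Rightarrow> real"
  assumes "pair_graph H" and "bipartition H X Y" and "orientation_of H\<tau> H"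
    and "card (pverts H) = m"
    and "pair_graph G" and "orientation_of G\<sigma> G"
    and "card (pverts G) = n"
    and "enumerates us (pverts H\<tau>)"
    and "enumerates vs (pverts G\<sigma>)"
    and "enumerates ws (pverts (cart_prod_o Y H\<tau> G\<sigma>))"
    and "\<And>j. j \<in> {1..t} \<Longrightarrow> \<mu> j \<noteq> 0"
    and "\<And>k. k \<in> {1..r} \<Longrightarrow> lam k \<noteq> 0"
    and "2 * t \<le> m" and "2 * r \<le> n"
    and "skew_eigenvalues us H\<tau> =
           (\<Sum>j=1..t. {#complex_of_real (\<mu> j) * \<i>, - (complex_of_real (\<mu> j) * \<i>)#})
           + replicate_mset (m - 2 * t) 0"
    and "skew_eigenvalues vs G\<sigma> =
           (\<Sum>k=1..r. {#complex_of_real (lam k) * \<i>, - (complex_of_real (lam k) * \<i>)#})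
           + replicate_mset (n - 2 * r) 0"
  shows "skew_eigenvalues ws (cart_prod_o Y H\<tau> G\<sigma>) =
           (\<Sum>j=1..t. \<Sum>k=1..r.
              replicate_mset 2 (\<i> * complex_of_real (sqrt ((\<mu> j)\<^sup>2 + (lam k)\<^sup>2)))
              + replicate_mset 2 (- (\<i> * complex_of_real (sqrt ((\<mu> j)\<^sup>2 + (lam k)\<^sup>2)))))
           + (\<Sum>j=1..t.
              replicate_mset (n - 2 * r) (complex_of_real (\<mu> j) * \<i>)
              + replicate_mset (n - 2 * r) (- (complex_of_real (\<mu> j) * \<i>)))
           + (\<Sum>k=1..r.
              replicate_mset (m - 2 * t) (complex_of_real (lam k) * \<i>)
              + replicate_mset (m - 2 * t) (- (complex_of_real (lam k) * \<i>)))
           + replicate_mset ((m - 2 * t) * (n - 2 * r)) 0"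
proof -
  let ?f = "\<lambda>x y :: complex. proots [:- (x\<^sup>2 + y\<^sup>2), 0, 1:]"
  let ?a = "\<lambda>j. complex_of_real (\<mu> j) * \<i>" and ?b = "\<lambda>k. complex_of_real (lam k) * \<i>"
  let ?c = "\<lambda>j k. \<i> * complex_of_real (sqrt ((\<mu> j)\<^sup>2 + (lam k)\<^sup>2))"
  let ?z = "m - 2 * t" and ?q = "n - 2 * r"
  have roots: "?f x y = {#c, - c#}" if "x\<^sup>2 + y\<^sup>2 = c\<^sup>2" for x y c
    unfolding that by (rule proots_square_minus_square)
  \<comment> \<open>For \<open>(?a j, 0)\<close> the roots are taken as \<open>\<plusminus> ?a j\<close> rather than \<open>\<plusminus> \<i> * sqrt ((\<mu> j)\<^sup>2)\<close>,
    which is correct for both signs of \<open>\<mu> j\<close>; likewise for \<open>lam k\<close>.\<close>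
  have f: "?f (?a j) (?b k) = {#?c j k, - ?c j k#}" "?f (?a j) 0 = {#?a j, - ?a j#}"
    "?f 0 (?b k) = {#?b k, - ?b k#}" "?f 0 0 = {#0, 0#}" for j k
  proof -
    have "(complex_of_real (sqrt ((\<mu> j)\<^sup>2 + (lam k)\<^sup>2)))\<^sup>2 = complex_of_real ((\<mu> j)\<^sup>2 + (lam k)\<^sup>2)"
      by (simp only: of_real_power[symmetric]) simp
    then have "(?a j)\<^sup>2 + (?b k)\<^sup>2 = (?c j k)\<^sup>2"
      by (simp add: power_mult_distrib)
    then show "?f (?a j) (?b k) = {#?c j k, - ?c j k#}" by (rule roots)
    show "?f (?a j) 0 = {#?a j, - ?a j#}" "?f 0 (?b k) = {#?b k, - ?b k#}" "?f 0 0 = {#0, 0#}"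
      using roots[of "?a j" 0 "?a j"] roots[of 0 "?b k" "?b k"] roots[of 0 0 0] by simp_all
  qed
  have pair: "replicate_mset k x + replicate_mset k (- x) = repeat_mset k {#x, - x#}" for k and x :: complex
    by simp
  have "orientation_of (cart_prod_o Y H\<tau> G\<sigma>) (cart_prod H G)"
    using assms(1,5,3,6) by (rule orientation_of_cart_prod_o)
  with assms(3,6,2,8,9,10) have "repeat_mset 2 (skew_eigenvalues ws (cart_prod_o Y H\<tau> G\<sigma>)) =
      (\<Sum>x\<in>#skew_eigenvalues us H\<tau>. \<Sum>y\<in>#skew_eigenvalues vs G\<sigma>. ?f x y)"
    by (rule double_skew_eigenvalues_cart_prod_o)
  \<comment> \<open>\<open>?f\<close> is even in both arguments, and both spectra are symmetric under negation.\<close>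
  also have "\<dots> = repeat_mset 2 (\<Sum>j=1..t. repeat_mset 2 (\<Sum>k=1..r. ?f (?a j) (?b k)) + repeat_mset ?q (?f (?a j) 0))
      + repeat_mset ?z (repeat_mset 2 (\<Sum>k=1..r. ?f 0 (?b k)) + repeat_mset ?q (?f 0 0))"
    unfolding assms(15,16) by (subst sum_mset_symmetric | simp)+
  also have "\<dots> = repeat_mset 2 (
           (\<Sum>j=1..t. \<Sum>k=1..r. replicate_mset 2 (?c j k) + replicate_mset 2 (- ?c j k))
           + (\<Sum>j=1..t. replicate_mset ?q (?a j) + replicate_mset ?q (- ?a j))
           + (\<Sum>k=1..r. replicate_mset ?z (?b k) + replicate_mset ?z (- ?b k))
           + replicate_mset (?z * ?q) 0)"
    unfolding f
    using collect_doubled_multiplicities[where J = "{1..t}" and K = "{1..r}" and q = ?q and z = ?z and a = "{#0#}"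
        and A = "\<lambda>j. {#?a j, - ?a j#}" and B = "\<lambda>k. {#?b k, - ?b k#}" and C = "\<lambda>j k. {#?c j k, - ?c j k#}"]
    by (simp only: pair) (simp add: numeral_2_eq_2)
  finally show ?thesis by (simp only: repeat_mset_cancel1) simp
qed

end
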